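(* Suppose that $f(z)=h(z)+\overline{g(z)}=\sum_{n=0}^\infty a_n z^n+\overline{\sum_{n=2}^\infty b_n z^n}$ is a sense-preserving harmonic mapping of the unit disk $\mathbb{D}$, where $h$ is bounded in $\mathbb{D}$. Then $$\sum_{n=0}^\infty |a_n|r^n+\sum_{n=2}^\infty |b_n|r^n\le\|h\|_\infty\quad\text{for } 0\le r\le r_\infty,$$ where $r_\infty=0.2942\ldots\in(0,1)$ is the positive root of the equation $$\frac{r}{1-r}+r^2\sqrt{\frac{1+r^2}{(1-r^2)^3}}\sqrt{\frac{\pi^2}{6}-1}=\frac12.$$ The number $r_\infty$ cannot be replaced by a number greater than $R=0.299825\ldots$, where $R\in(0,1)$ is the positive root of the equation $$\frac{4R}{1-R}+2\log(1-R)=1;$$ that is, for every $r\in(R,1)$ there is such an $f$ for which the inequality fails at $r$.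
   Context: $\mathbb{D}=\{z\in\mathbb{C}:|z|<1\}$ and $\|h\|_\infty=\sup_{z\in\mathbb{D}}|h(z)|$. A harmonic mapping in $\mathbb{D}$ is a complex-valued function $f$ with $\Delta f=0$; it is written $f=h+\overline{g}$ with $h,g$ analytic in $\mathbb{D}$ and $g(0)=0$; here $h(z)=\sum_{n\ge0}a_nz^n$ and $g(z)=\sum_{n\ge2}b_nz^n$ (so $g(0)=g'(0)=0$). It is (locally univalent and) sense-preserving if its Jacobian $J_f=|h'|^2-|g'|^2$ is positive in $\mathbb{D}$; equivalently $h'\neq0$ and the dilatation $\omega_f=g'/h'$ satisfies $|\omega_f|<1$ in $\mathbb{D}$.
   Formalization: The printed digits R = 0.299825… are incorrect (the root of the equation is 0.2998235…); the formal statement defines R exactly by its equation and asserts |R − 0.299825| < 0.000002 instead. *)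

theory Defs
  imports "HOL-Complex_Analysis.Complex_Analysis"
begin

abbreviation unit_disk :: "complex set" where
  "unit_disk \<equiv> ball 0 1"

definition disk_sup_norm :: "(complex \<Rightarrow> complex) \<Rightarrow> real" where
  "disk_sup_norm h = (SUP z\<in>unit_disk. norm (h z))"

text \<open>Partial derivatives with respect to \<open>x = Re z\<close> and \<open>y = Im z\<close>.\<close>

definition partial_x :: "(complex \<Rightarrow> complex) \<Rightarrow> complex \<Rightarrow> complex" where
  "partial_x f z = vector_derivative (\<lambda>t::real. f (z + of_real t)) (at 0)"

definition partial_y :: "(complex \<Rightarrow> complex) \<Rightarrow> complex \<Rightarrow> complex" where
  "partial_y f z = vector_derivative (\<lambda>t::real. f (z + \<i> * of_real t)) (at 0)"

definition laplacian :: "(complex \<Rightarrow> complex) \<Rightarrow> complex \<Rightarrow> complex" where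
  "laplacian f z = partial_x (partial_x f) z + partial_y (partial_y f) z"

text \<open>In the next three definitions \<open>S\<close> is meant to be open; \<open>differentiable\<close> is real
  (Frechet) differentiability, so it does not imply holomorphy.\<close>

definition C1_on :: "(complex \<Rightarrow> complex) \<Rightarrow> complex set \<Rightarrow> bool" where
  "C1_on f S \<longleftrightarrow> (\<forall>z\<in>S. f differentiable (at z)) \<and>
     continuous_on S (partial_x f) \<and> continuous_on S (partial_y f)"

definition C2_on :: "(complex \<Rightarrow> complex) \<Rightarrow> complex set \<Rightarrow> bool" where
  "C2_on f S \<longleftrightarrow> C1_on f S \<and> C1_on (partial_x f) S \<and> C1_on (partial_y f) S"

definition harmonic_on :: "(complex \<Rightarrow> complex) \<Rightarrow> complex set \<Rightarrow> bool" where
  "harmonic_on f S \<longleftrightarrow> C2_on f S \<and> (\<forall>z\<in>S. laplacian f z = 0)"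

text \<open>The Jacobian of \<open>f = h + cnj g\<close> for holomorphic \<open>h\<close>, \<open>g\<close>.\<close>

definition harmonic_jacobian ::
    "(complex \<Rightarrow> complex) \<Rightarrow> (complex \<Rightarrow> complex) \<Rightarrow> complex \<Rightarrow> real" where
  "harmonic_jacobian h g z = (norm (deriv h z))\<^sup>2 - (norm (deriv g z))\<^sup>2"

definition sense_preserving_harmonic_mapping ::
    "(complex \<Rightarrow> complex) \<Rightarrow> (complex \<Rightarrow> complex) \<Rightarrow> (complex \<Rightarrow> complex) \<Rightarrow> bool" where
  "sense_preserving_harmonic_mapping f h g \<longleftrightarrow>
     harmonic_on f unit_disk \<and>
     h holomorphic_on unit_disk \<and> g holomorphic_on unit_disk \<and> g 0 = 0 \<and>
     (\<forall>z\<in>unit_disk. f z = h z + cnj (g z)) \<and>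
     (\<forall>z\<in>unit_disk. harmonic_jacobian h g z > 0)"

text \<open>The expansion of \<open>g\<close> starts at \<open>n = 2\<close>; the values \<open>b 0\<close> and \<open>b 1\<close> are irrelevant.\<close>

definition has_coefficients ::
    "(complex \<Rightarrow> complex) \<Rightarrow> (complex \<Rightarrow> complex) \<Rightarrow>
     (nat \<Rightarrow> complex) \<Rightarrow> (nat \<Rightarrow> complex) \<Rightarrow> bool" where
  "has_coefficients h g a b \<longleftrightarrow>
     (\<forall>z\<in>unit_disk. (\<lambda>n. a n * z ^ n) sums h z) \<and>
     (\<forall>z\<in>unit_disk. (\<lambda>n. b (n + 2) * z ^ (n + 2)) sums g z)"

text \<open>If \<open>has_coefficients h g a b\<close> holds, both series converge for \<open>0 \<le> r < 1\<close>, since power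
  series converge absolutely inside their disk of convergence.\<close>

definition majorant_sum :: "(nat \<Rightarrow> complex) \<Rightarrow> (nat \<Rightarrow> complex) \<Rightarrow> real \<Rightarrow> real" where
  "majorant_sum a b r =
     (\<Sum>n. norm (a n) * r ^ n) + (\<Sum>n. norm (b (n + 2)) * r ^ (n + 2))"

end

theory Submission
  imports Defs
begin

text \<open>
  Normalise \<open>\<bar>h\<bar> \<le> 1\<close> and put \<open>K = 1 - \<bar>a\<^sub>0\<bar>\<^sup>2\<close>. The classical coefficient estimate
  \<open>\<bar>a\<^sub>n\<bar> \<le> K\<close> for \<open>n \<ge> 1\<close> (\<open>bounded_power_series_coeff_le\<close>) bounds the analytic part of the majorant
  series by \<open>\<bar>a\<^sub>0\<bar> + K r/(1 - r)\<close>. For the co-analytic part, the dilatation \<open>g'/h'\<close> maps the disk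
  into itself and vanishes at \<open>0\<close>, because \<open>g'(0) = 0\<close>; by the Schwarz lemma
  \<open>\<bar>g'(z)\<bar> \<le> \<bar>z h'(z)\<bar>\<close> (\<open>dilatation_bound\<close>). Integrating the squares over the circle of radius \<open>r\<close> and using
  Parseval's identity (\<open>power_series_l2_mono\<close>) turns this into
  \<open>\<Sum> n\<^sup>2\<bar>b\<^sub>n\<bar>\<^sup>2 r\<^bsup>2(n-1)\<^esup> \<le> \<Sum> n\<^sup>2\<bar>a\<^sub>n\<bar>\<^sup>2 r\<^bsup>2n\<^esup> \<le> K\<^sup>2 \<Sum> n\<^sup>2 r\<^bsup>2n\<^esup>\<close>. By the Cauchy-Schwarz inequality against the sequence
  \<open>1/n\<close> for \<open>n \<ge> 2\<close>, whose squares have the sum \<open>\<pi>\<^sup>2/6 - 1\<close>, the co-analytic part is at most \<open>K\<close> times the second summand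
  of the equation that defines the radius. The whole majorant sum is therefore at most
  \<open>\<bar>a\<^sub>0\<bar> + (1 - \<bar>a\<^sub>0\<bar>\<^sup>2) F(r)\<close>, where \<open>F\<close> is the left-hand side of that equation
  (\<open>majorant_sum_le\<close>), and \<open>F(r) \<le> 1/2\<close> makes this at most
  \<open>1 - (1 - \<bar>a\<^sub>0\<bar>)\<^sup>2/2 \<le> 1\<close>.

  For the upper bound on the radius take the disk automorphism \<open>h(z) = (z - t)/(1 - t z)\<close> with
  \<open>g' = z h'\<close>, so that the Schwarz estimate is an equality. Its majorant sum has the form \<open>t + (1 - t\<^sup>2) S\<^sub>t(r)\<close>, which exceeds
  \<open>1\<close> exactly when \<open>(1 + t) S\<^sub>t(r) > 1\<close>; as \<open>t \<rightarrow> 1\<close> the left-hand side tends to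
  \<open>4r/(1 - r) + 2 ln (1 - r)\<close> (\<open>Moebius_example\<close>, \<open>Moebius_weight_sums\<close>).
\<close>

section \<open>Parseval's identity for power series\<close>

lemma has_integral_cis_period:
  assumes "k \<noteq> (0::nat)"
  shows "((\<lambda>t. cis (- (real k * t))) has_integral 0) {0..2 * pi}"
proof -
  have *: "((\<lambda>t. \<i> / of_nat k * cis (- (real k * t))) has_vector_derivative cis (- (real k * t))) (at t within {0..2 * pi})" for t
  proof -
    have "((\<lambda>z. \<i> / of_nat k * exp (- \<i> * of_nat k * z)) has_field_derivative exp (- \<i> * of_nat k * of_real t)) (at (of_real t))"
      using assms by (auto intro!: derivative_eq_intros simp: field_simps)
    from has_vector_derivative_at_within[OF has_vector_derivative_real_field[OF this]]
    have "((\<lambda>t. \<i> / of_nat k * exp (- \<i> * of_nat k * of_real t)) has_vector_derivative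
        exp (- \<i> * of_nat k * of_real t)) (at t within {0..2 * pi})" .
    moreover have "exp (- \<i> * of_nat k * of_real x) = cis (- (real k * x))" for x
      by (simp add: cis_conv_exp mult.assoc)
    ultimately show ?thesis by (simp only:)
  qed
  have "((\<lambda>t. cis (- (real k * t))) has_integral
      (\<i> / of_nat k * cis (- (real k * (2 * pi))) - \<i> / of_nat k * cis (- (real k * 0)))) {0..2 * pi}"
    by (rule fundamental_theorem_of_calculus) (use * in auto)
  moreover have "cis (- (real k * (2 * pi))) = 1"
    using cis_multiple_2pi[of "- real k"] by (simp add: mult_ac)
  ultimately show ?thesis by simp
qed

lemma cmod_add_power2: "(norm (x + y :: complex))\<^sup>2 = (norm x)\<^sup>2 + (norm y)\<^sup>2 + 2 * Re (cnj y * x)"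
  unfolding cmod_power2 by (simp add: power2_eq_square algebra_simps)

text \<open>Adding the frequency \<open>N\<close> to a trigonometric polynomial of lower degree contributes
  \<open>\<bar>c\<^sub>N\<bar>\<^sup>2\<close>; the mixed term is a combination of the functions \<open>cis (- k t)\<close> with
  \<open>1 \<le> k \<le> N\<close>, whose integrals over a period vanish.\<close>

lemma Parseval_trig_polynomial:
  "((\<lambda>t. (norm (\<Sum>n<N. c n * cis (real n * t)))\<^sup>2) has_integral
     2 * pi * (\<Sum>n<N. (norm (c n))\<^sup>2)) {0..2 * pi}"
proof (induction N)
  case 0
  then show ?case by simp
next
  case (Suc N)
  have "((\<lambda>t. \<Sum>n<N. cnj (c N) * c n * cis (- (real (N - n) * t))) has_integral
      (\<Sum>n<N. cnj (c N) * c n * 0)) {0..2 * pi}"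
    by (rule has_integral_sum, simp, rule has_integral_mult_right, rule has_integral_cis_period) auto
  moreover have "(\<Sum>n<N. cnj (c N) * c n * cis (- (real (N - n) * t)))
      = cnj (c N * cis (real N * t)) * (\<Sum>n<N. c n * cis (real n * t))" for t
    unfolding sum_distrib_left
  proof (rule sum.cong[OF refl])
    fix n assume "n \<in> {..<N}"
    then have "cis (- (real (N - n) * t)) = cis (real n * t) * cnj (cis (real N * t))"
      by (simp add: cis_cnj cis_mult of_nat_diff algebra_simps)
    then show "cnj (c N) * c n * cis (- (real (N - n) * t))
        = cnj (c N * cis (real N * t)) * (c n * cis (real n * t))"
      by (simp add: mult_ac)
  qed
  ultimately have "((\<lambda>t. cnj (c N * cis (real N * t)) * (\<Sum>n<N. c n * cis (real n * t))) has_integral 0) {0..2 * pi}"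
    by simp
  from has_integral_linear[OF this bounded_linear_Re]
  have cross: "((\<lambda>t. Re (cnj (c N * cis (real N * t)) * (\<Sum>n<N. c n * cis (real n * t)))) has_integral 0) {0..2 * pi}"
    by (simp only: o_def zero_complex.sel)
  have const: "((\<lambda>t. (norm (c N))\<^sup>2) has_integral 2 * pi * (norm (c N))\<^sup>2) {0..2 * pi}"
    using has_integral_const_real[of "(norm (c N))\<^sup>2" 0 "2 * pi"] by simp
  have expand: "(norm (\<Sum>n<Suc N. c n * cis (real n * t)))\<^sup>2
      = (norm (\<Sum>n<N. c n * cis (real n * t)))\<^sup>2 + (norm (c N))\<^sup>2
        + 2 * Re (cnj (c N * cis (real N * t)) * (\<Sum>n<N. c n * cis (real n * t)))" for t
    unfolding sum.lessThan_Suc cmod_add_power2 by (simp only: norm_mult norm_cis mult_1_right)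
  have total: "2 * pi * (\<Sum>n<Suc N. (norm (c n))\<^sup>2)
      = 2 * pi * (\<Sum>n<N. (norm (c n))\<^sup>2) + 2 * pi * (norm (c N))\<^sup>2 + 2 * 0"
    by (simp add: distrib_left)
  show ?case
    unfolding expand total
    by (rule has_integral_add[OF has_integral_add[OF Suc.IH const]
          has_integral_mult_right[OF cross]])
qed

text \<open>Absolute convergence bounds all partial sums by the constant \<open>\<Sum> \<bar>c\<^sub>n\<bar>\<close>, so the
  identity for trigonometric polynomials passes to the limit by dominated convergence.\<close>

lemma Parseval_absolutely_convergent:
  assumes "summable (\<lambda>n. norm (c n))"
  shows "summable (\<lambda>n. (norm (c n))\<^sup>2)"
    and "((\<lambda>t. (norm (\<Sum>n. c n * cis (real n * t)))\<^sup>2) has_integral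
           2 * pi * (\<Sum>n. (norm (c n))\<^sup>2)) {0..2 * pi}"
proof -
  show sq: "summable (\<lambda>n. (norm (c n))\<^sup>2)"
  proof -
    \<comment> \<open>Eventually \<open>\<bar>c\<^sub>n\<bar> < 1\<close>, and then the square is the smaller number.\<close>
    have "eventually (\<lambda>n. norm (c n) < 1) sequentially"
      using summable_LIMSEQ_zero[OF assms] by (rule order_tendstoD) simp
    then have "eventually (\<lambda>n. norm ((norm (c n))\<^sup>2) \<le> norm (c n)) sequentially"
      by eventually_elim (simp add: power2_eq_square mult_left_le)
    then show ?thesis using assms by (rule summable_comparison_test_ev)
  qed
  define S where "S N t = (\<Sum>n<N. c n * cis (real n * t))" for N t
  define C where "C = (\<Sum>n. norm (c n))"
  let ?f = "\<lambda>t. (norm (\<Sum>n. c n * cis (real n * t)))\<^sup>2"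
  have summ: "summable (\<lambda>n. c n * cis (real n * t))" for t
    by (rule summable_norm_cancel) (simp add: norm_mult assms)
  have "norm (S N t) \<le> C" for N t
  proof -
    have "norm (S N t) \<le> (\<Sum>n<N. norm (c n))"
      unfolding S_def by (rule order_trans[OF norm_sum]) (simp add: norm_mult)
    also have "\<dots> \<le> C" unfolding C_def by (rule sum_le_suminf) (use assms in auto)
    finally show ?thesis .
  qed
  then have bound: "norm ((norm (S N t))\<^sup>2) \<le> C\<^sup>2" for N t
    by (simp add: power_mono)
  have int: "((\<lambda>t. (norm (S N t))\<^sup>2) has_integral 2 * pi * (\<Sum>n<N. (norm (c n))\<^sup>2)) {0..2 * pi}" for N
    unfolding S_def by (rule Parseval_trig_polynomial)
  have lim: "(\<lambda>N. (norm (S N t))\<^sup>2) \<longlonglongrightarrow> ?f t" for t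
    unfolding S_def by (intro tendsto_intros summable_LIMSEQ summ)
  have f_int: "?f integrable_on {0..2 * pi}"
    and lim1: "(\<lambda>N. integral {0..2 * pi} (\<lambda>t. (norm (S N t))\<^sup>2)) \<longlonglongrightarrow> integral {0..2 * pi} ?f"
  proof -
    have C_int: "(\<lambda>_. C\<^sup>2) integrable_on {0..2 * pi}"
      by (rule integrable_const_ivl)
    show "?f integrable_on {0..2 * pi}"
      by (rule dominated_convergence(1)[OF has_integral_integrable[OF int] C_int bound lim])
    show "(\<lambda>N. integral {0..2 * pi} (\<lambda>t. (norm (S N t))\<^sup>2)) \<longlonglongrightarrow> integral {0..2 * pi} ?f"
      by (rule dominated_convergence(2)[OF has_integral_integrable[OF int] C_int bound lim])
  qed
  have lim2: "(\<lambda>N. integral {0..2 * pi} (\<lambda>t. (norm (S N t))\<^sup>2)) \<longlonglongrightarrow> 2 * pi * (\<Sum>n. (norm (c n))\<^sup>2)"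
    unfolding integral_unique[OF int] by (intro tendsto_intros summable_LIMSEQ sq)
  show "(?f has_integral 2 * pi * (\<Sum>n. (norm (c n))\<^sup>2)) {0..2 * pi}"
    using integrable_integral[OF f_int] unfolding LIMSEQ_unique[OF lim1 lim2] .
qed

text \<open>By Parseval, both sums are the mean values of \<open>\<bar>\<phi>\<bar>\<^sup>2\<close> and \<open>\<bar>\<psi>\<bar>\<^sup>2\<close> over the circle of
  radius \<open>r\<close>. This is what turns a pointwise estimate of functions into an estimate of coefficients.\<close>

lemma power_series_l2_mono:
  fixes c d :: "nat \<Rightarrow> complex"
  assumes c: "\<And>z. norm z < 1 \<Longrightarrow> (\<lambda>n. c n * z ^ n) sums \<phi> z"
    and d: "\<And>z. norm z < 1 \<Longrightarrow> (\<lambda>n. d n * z ^ n) sums \<psi> z"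
    and le: "\<And>z. norm z < 1 \<Longrightarrow> norm (\<phi> z) \<le> norm (\<psi> z)"
    and r: "0 \<le> r" "r < 1"
  shows "summable (\<lambda>n. (norm (c n) * r ^ n)\<^sup>2)"
    and "summable (\<lambda>n. (norm (d n) * r ^ n)\<^sup>2)"
    and "(\<Sum>n. (norm (c n) * r ^ n)\<^sup>2) \<le> (\<Sum>n. (norm (d n) * r ^ n)\<^sup>2)"
proof -
  have abs: "summable (\<lambda>n. norm (e n * of_real r ^ n))"
    if e: "\<And>z. norm z < 1 \<Longrightarrow> (\<lambda>n. e n * z ^ n) sums u z" for e :: "nat \<Rightarrow> complex" and u
  \<comment> \<open>The power series converges at the radius \<open>(1 + r)/2\<close>, hence absolutely at \<open>r\<close>.\<close>
  proof (rule powser_insidea)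
    show "summable (\<lambda>n. e n * of_real ((1 + r) / 2) ^ n)"
      by (rule sums_summable[OF e]) (use r in \<open>simp only: norm_of_real, simp\<close>)
    show "norm (complex_of_real r) < norm (complex_of_real ((1 + r) / 2))"
      using r by (simp only: norm_of_real) simp
  qed
  have par: "summable (\<lambda>n. (norm (e n) * r ^ n)\<^sup>2)"
      "((\<lambda>t. (norm (u (of_real r * cis t)))\<^sup>2) has_integral
         2 * pi * (\<Sum>n. (norm (e n) * r ^ n)\<^sup>2)) {0..2 * pi}"
    if e: "\<And>z. norm z < 1 \<Longrightarrow> (\<lambda>n. e n * z ^ n) sums u z" for e :: "nat \<Rightarrow> complex" and u
  proof -
    have n: "norm (e n * of_real r ^ n) = norm (e n) * r ^ n" for n
      using r by (simp add: norm_mult norm_power)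
    have "(\<Sum>n. e n * of_real r ^ n * cis (real n * t)) = u (of_real r * cis t)" for t
    proof -
      have "(\<lambda>n. e n * (of_real r * cis t) ^ n) sums u (of_real r * cis t)"
        by (rule e) (use r in \<open>simp add: norm_mult\<close>)
      then show ?thesis
        unfolding power_mult_distrib Complex.DeMoivre mult.assoc[symmetric] by (rule sums_unique[symmetric])
    qed
    then show "summable (\<lambda>n. (norm (e n) * r ^ n)\<^sup>2)"
      "((\<lambda>t. (norm (u (of_real r * cis t)))\<^sup>2) has_integral
         2 * pi * (\<Sum>n. (norm (e n) * r ^ n)\<^sup>2)) {0..2 * pi}"
      using Parseval_absolutely_convergent[OF abs[OF e]] unfolding n by simp_all
  qed
  show "summable (\<lambda>n. (norm (c n) * r ^ n)\<^sup>2)" "summable (\<lambda>n. (norm (d n) * r ^ n)\<^sup>2)"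
    by (rule par(1)[OF c], assumption, rule par(1)[OF d])
  have "2 * pi * (\<Sum>n. (norm (c n) * r ^ n)\<^sup>2) \<le> 2 * pi * (\<Sum>n. (norm (d n) * r ^ n)\<^sup>2)"
  proof (rule has_integral_le[OF par(2)[OF c] par(2)[OF d]])
    fix t
    show "(norm (\<phi> (of_real r * cis t)))\<^sup>2 \<le> (norm (\<psi> (of_real r * cis t)))\<^sup>2"
      by (rule power_mono[OF le norm_ge_zero]) (use r in \<open>simp add: norm_mult\<close>)
  qed
  then show "(\<Sum>n. (norm (c n) * r ^ n)\<^sup>2) \<le> (\<Sum>n. (norm (d n) * r ^ n)\<^sup>2)"
    by simp
qed

section \<open>Coefficients of bounded analytic functions\<close>

text \<open>Multiplication by \<open>h\<close> does not increase the \<open>L\<^sup>2\<close> norm on circles. Applied to \<open>1 + y z\<^sup>n\<close>, of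
  which only the coefficients \<open>0\<close> and \<open>n\<close> of the product are kept, this gives
  \<open>\<bar>a\<^sub>0\<bar>\<^sup>2 + \<bar>a\<^sub>n + y a\<^sub>0\<bar>\<^sup>2 \<le> 1 + \<bar>y\<bar>\<^sup>2\<close> for every \<open>y\<close>, that is, the matrix with rows
  \<open>(a\<^sub>0, 0)\<close> and \<open>(a\<^sub>n, a\<^sub>0)\<close> does not increase the norm of \<open>(1, y)\<close>. The best \<open>y\<close> yields the estimate.\<close>

lemma bounded_power_series_coeff_le_unit:
  fixes a :: "nat \<Rightarrow> complex"
  assumes a: "\<And>z. norm z < 1 \<Longrightarrow> (\<lambda>n. a n * z ^ n) sums h z"
    and le: "\<And>z. norm z < 1 \<Longrightarrow> norm (h z) \<le> 1"
    and n: "n > 0"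
  shows "norm (a n) \<le> 1 - (norm (a 0))\<^sup>2"
proof -
  have key: "(norm (a 0))\<^sup>2 + (norm (a n + y * a 0))\<^sup>2 \<le> 1 + (norm y)\<^sup>2" for y
  proof -
    define c where "c k = a k + (if k < n then 0 else y * a (k - n))" for k
    define d :: "nat \<Rightarrow> complex" where "d k = (if k = 0 then 1 else if k = n then y else 0)" for k
    have c: "(\<lambda>k. c k * z ^ k) sums (h z * (1 + y * z ^ n))" if z: "norm z < 1" for z
    proof -
      have "(\<lambda>k. if k < n then 0 else y * z ^ n * (a (k - n) * z ^ (k - n))) sums (y * z ^ n * h z)"
        using sums_zero_iff_shift[of n "\<lambda>k. if k < n then 0 else y * z ^ n * (a (k - n) * z ^ (k - n))"]
          sums_mult[OF a[OF z], of "y * z ^ n"] by simp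
      from sums_add[OF a[OF z] this]
      have "(\<lambda>k. a k * z ^ k + (if k < n then 0 else y * z ^ n * (a (k - n) * z ^ (k - n)))) sums (h z * (1 + y * z ^ n))"
        by (simp add: algebra_simps)
      moreover have "a k * z ^ k + (if k < n then 0 else y * z ^ n * (a (k - n) * z ^ (k - n))) = c k * z ^ k" for k
        unfolding c_def by (simp add: algebra_simps flip: power_add)
      ultimately show ?thesis by simp
    qed
    have d: "(\<lambda>k. d k * z ^ k) sums (1 + y * z ^ n)" for z
    proof -
      have "(\<lambda>k. d k * z ^ k) sums (\<Sum>k\<in>{0, n}. d k * z ^ k)"
        by (rule sums_finite) (auto simp: d_def)
      then show ?thesis using n by (simp add: d_def)
    qed
    have "(norm (c 0))\<^sup>2 + (norm (c n) * r ^ n)\<^sup>2 \<le> 1 + (norm y * r ^ n)\<^sup>2" if r: "0 < r" "r < 1" for r :: real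
    proof -
      have "norm (h z * (1 + y * z ^ n)) \<le> norm (1 + y * z ^ n)" if "norm z < 1" for z
        using le[OF that] by (simp add: norm_mult mult_left_le_one_le)
      note l2 = power_series_l2_mono[OF c d this, of r]
      have "(\<Sum>k\<in>{0, n}. (norm (c k) * r ^ k)\<^sup>2) \<le> (\<Sum>k. (norm (c k) * r ^ k)\<^sup>2)"
        by (rule sum_le_suminf[OF l2(1)]) (use r in auto)
      also have "\<dots> \<le> (\<Sum>k. (norm (d k) * r ^ k)\<^sup>2)" using l2(3) r by simp
      also have "\<dots> = (\<Sum>k\<in>{0, n}. (norm (d k) * r ^ k)\<^sup>2)"
        by (rule suminf_finite) (auto simp: d_def)
      finally show ?thesis using n by (simp add: d_def)
    qed
    \<comment> \<open>The inequality at radius \<open>r < 1\<close> passes to \<open>r \<rightarrow> 1\<close>, since only finitely many terms occur.\<close>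
    then have ev: "eventually (\<lambda>r. (norm (c 0))\<^sup>2 + (norm (c n) * r ^ n)\<^sup>2 \<le> 1 + (norm y * r ^ n)\<^sup>2) (at_left (1::real))"
      using eventually_at_left_real[of 0 1] by (auto elim: eventually_mono)
    have "(norm (c 0))\<^sup>2 + (norm (c n) * 1 ^ n)\<^sup>2 \<le> 1 + (norm y * 1 ^ n)\<^sup>2"
      by (rule tendsto_le[OF trivial_limit_at_left_real _ _ ev]) (intro tendsto_intros)+
    then show ?thesis using n by (simp add: c_def)
  qed
  define A where "A = norm (a 0)"
  define B where "B = norm (a n)"
  have AB: "A\<^sup>2 + B\<^sup>2 \<le> 1" using key[of 0] by (simp add: A_def B_def)
  show ?thesis
  proof (cases "A\<^sup>2 = 1")
    case True
    then show ?thesis using AB by (simp add: A_def B_def)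
  next
    case False
    with AB have lt: "1 - A\<^sup>2 > 0" using zero_le_power2[of B] by linarith
    \<comment> \<open>This \<open>y\<close> maximises \<open>\<bar>a\<^sub>n + y a\<^sub>0\<bar>\<^sup>2 - \<bar>y\<bar>\<^sup>2\<close>.\<close>
    define y where "y = a n * cnj (a 0) / of_real (1 - A\<^sup>2)"
    have "a n + y * a 0 = a n / of_real (1 - A\<^sup>2)"
    proof -
      have "a n + y * a 0 = (a n * of_real (1 - A\<^sup>2) + a n * (a 0 * cnj (a 0))) / of_real (1 - A\<^sup>2)"
        unfolding y_def using lt by (simp add: field_simps del: of_real_diff of_real_power)
      also have "a 0 * cnj (a 0) = of_real (A\<^sup>2)"
        by (simp add: A_def complex_norm_square[symmetric])
      finally show ?thesis by (simp add: algebra_simps)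
    qed
    then have 1: "norm (a n + y * a 0) = B / (1 - A\<^sup>2)"
      using lt by (simp add: B_def norm_divide del: of_real_diff of_real_power)
    have 2: "norm y = A * B / (1 - A\<^sup>2)"
      using lt by (simp add: y_def A_def B_def norm_mult norm_divide del: of_real_diff of_real_power)
    define D where "D = 1 - A\<^sup>2"
    have "(B / D)\<^sup>2 - (A * B / D)\<^sup>2 = (1 - A\<^sup>2) * B\<^sup>2 / D\<^sup>2"
      by (simp add: power_divide power_mult_distrib left_diff_distrib diff_divide_distrib)
    also have "\<dots> = B\<^sup>2 / D"
      using lt unfolding D_def[symmetric] by (simp add: power2_eq_square)
    finally have "(B / (1 - A\<^sup>2))\<^sup>2 - (A * B / (1 - A\<^sup>2))\<^sup>2 = B\<^sup>2 / (1 - A\<^sup>2)"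
      by (simp only: D_def)
    then have "B\<^sup>2 / (1 - A\<^sup>2) \<le> 1 - A\<^sup>2"
      using key[of y] unfolding 1 2 A_def[symmetric] by linarith
    then have "B\<^sup>2 \<le> (1 - A\<^sup>2)\<^sup>2"
      using lt by (simp add: pos_divide_le_eq power2_eq_square)
    then show ?thesis using lt power2_le_imp_le[of B "1 - A\<^sup>2"] by (simp add: A_def B_def)
  qed
qed

lemma bounded_power_series_coeff_le:
  fixes a :: "nat \<Rightarrow> complex"
  assumes a: "\<And>z. norm z < 1 \<Longrightarrow> (\<lambda>n. a n * z ^ n) sums h z"
    and le: "\<And>z. norm z < 1 \<Longrightarrow> norm (h z) \<le> M"
    and M: "M > 0" and n: "n > 0"
  shows "norm (a n) \<le> M - (norm (a 0))\<^sup>2 / M"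
proof -
  have "norm (a n / of_real M) \<le> 1 - (norm (a 0 / of_real M))\<^sup>2"
  proof (rule bounded_power_series_coeff_le_unit[OF _ _ n])
    fix z :: complex assume z: "norm z < 1"
    show "(\<lambda>n. a n / of_real M * z ^ n) sums (h z / of_real M)"
      using sums_divide[OF a[OF z], of "of_real M"] by simp
    show "norm (h z / of_real M) \<le> 1"
      using le[OF z] M by (simp add: norm_divide)
  qed
  then show ?thesis using M by (simp add: norm_divide field_simps power2_eq_square)
qed

section \<open>The defining equations of the two radii\<close>

text \<open>The left-hand side of the equation for the radius. It is the factor of \<open>M - \<bar>a\<^sub>0\<bar>\<^sup>2/M\<close> in the bound
  for the majorant sum when \<open>\<bar>h\<bar> \<le> M\<close>.\<close>

definition bohr_weight :: "real \<Rightarrow> real" where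
  "bohr_weight r = r / (1 - r) + r\<^sup>2 * sqrt ((1 + r\<^sup>2) / (1 - r\<^sup>2) ^ 3) * sqrt (pi\<^sup>2 / 6 - 1)"

lemma bohr_weight_strict_mono:
  assumes "0 < r" "r < s" "s < 1"
  shows "bohr_weight r < bohr_weight s"
proof -
  have "r / (1 - r) < s / (1 - s)" using assms by (simp add: field_simps)
  moreover have "r\<^sup>2 * sqrt ((1 + r\<^sup>2) / (1 - r\<^sup>2) ^ 3) * sqrt (pi\<^sup>2 / 6 - 1)
     \<le> s\<^sup>2 * sqrt ((1 + s\<^sup>2) / (1 - s\<^sup>2) ^ 3) * sqrt (pi\<^sup>2 / 6 - 1)"
  proof -
    have sq: "r\<^sup>2 \<le> s\<^sup>2" "s\<^sup>2 < 1"
      using assms by (auto intro: power_mono simp: abs_square_less_1)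
    then have "(1 + r\<^sup>2) / (1 - r\<^sup>2) ^ 3 \<le> (1 + s\<^sup>2) / (1 - s\<^sup>2) ^ 3"
      by (intro frac_le power_mono) auto
    moreover have "0 \<le> sqrt (pi\<^sup>2 / 6 - 1)"
      using power_mono[of 3 pi 2] pi_gt3 by simp
    moreover have "0 \<le> (1 + r\<^sup>2) / (1 - r\<^sup>2) ^ 3"
      using sq by simp
    ultimately show ?thesis
      using sq by (intro mult_right_mono mult_mono real_sqrt_le_mono) auto
  qed
  ultimately show ?thesis unfolding bohr_weight_def by linarith
qed

lemma bohr_weight_continuous: "continuous_on {0<..<1} bohr_weight"
  unfolding bohr_weight_def by (intro continuous_intros) (auto simp: power2_eq_1_iff)

lemma bohr_weight_values: "bohr_weight 0.2942 < 1/2" "bohr_weight 0.2943 > 1/2"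
proof -
  \<comment> \<open>The root \<open>sqrt (pi\<^sup>2 / 6 - 1)\<close> is \<open>0.803077...\<close>.\<close>
  have pi: "pi\<^sup>2 / 6 - 1 \<le> (0.80308)\<^sup>2" "pi\<^sup>2 / 6 - 1 \<ge> (0.80307)\<^sup>2"
    using power_mono[OF pi_approx(1), of 2] power_mono[OF pi_approx(2), of 2] by (simp_all add: power2_eq_square)
  have nonneg: "0 \<le> sqrt (pi\<^sup>2 / 6 - 1)"
    by (rule real_sqrt_ge_zero, rule order_trans[OF _ pi(2)]) simp
  show "bohr_weight 0.2942 < 1/2"
  proof -
    define X where "X = sqrt ((1 + 0.2942\<^sup>2) / (1 - 0.2942\<^sup>2) ^ 3) * sqrt (pi\<^sup>2 / 6 - 1)"
    \<comment> \<open>The root is \<open>1.19399...\<close>.\<close>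
    have "sqrt ((1 + 0.2942\<^sup>2) / (1 - 0.2942\<^sup>2) ^ 3) \<le> (1.194::real)"
      by (rule real_le_lsqrt) (simp_all add: power2_eq_square power3_eq_cube)
    moreover have "sqrt (pi\<^sup>2 / 6 - 1) \<le> 0.80308" using pi by (intro real_le_lsqrt) auto
    ultimately have "X \<le> 1.194 * 0.80308"
      unfolding X_def using nonneg by (intro mult_mono) auto
    moreover have "bohr_weight 0.2942 = 0.2942 / (1 - 0.2942) + 0.2942\<^sup>2 * X"
      by (simp only: bohr_weight_def X_def mult.assoc)
    ultimately show ?thesis by (simp add: power2_eq_square)
  qed
  show "bohr_weight 0.2943 > 1/2"
  proof -
    define X where "X = sqrt ((1 + 0.2943\<^sup>2) / (1 - 0.2943\<^sup>2) ^ 3) * sqrt (pi\<^sup>2 / 6 - 1)"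
    \<comment> \<open>The root is \<open>1.19413...\<close>.\<close>
    have "sqrt ((1 + 0.2943\<^sup>2) / (1 - 0.2943\<^sup>2) ^ 3) \<ge> (1.1941::real)"
      by (rule real_le_rsqrt) (simp_all add: power2_eq_square power3_eq_cube)
    moreover have "sqrt (pi\<^sup>2 / 6 - 1) \<ge> 0.80307" using pi by (intro real_le_rsqrt) auto
    ultimately have "X \<ge> 1.1941 * 0.80307"
      unfolding X_def by (rule mult_mono') simp_all
    moreover have "bohr_weight 0.2943 = 0.2943 / (1 - 0.2943) + 0.2943\<^sup>2 * X"
      by (simp only: bohr_weight_def X_def mult.assoc)
    ultimately show ?thesis by (simp add: power2_eq_square)
  qed
qed

text \<open>The left-hand side of the equation for the upper bound on the radius: twice the sum of the weights of the
  Moebius family in the limit \<open>t \<rightarrow> 1\<close>.\<close>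

definition sharpness_weight :: "real \<Rightarrow> real" where "sharpness_weight r = 4 * r / (1 - r) + 2 * ln (1 - r)"

lemma sharpness_weight_strict_mono:
  assumes "0 < r" "r < s" "s < 1"
  shows "sharpness_weight r < sharpness_weight s"
proof (rule DERIV_pos_imp_increasing[OF assms(2)])
  fix x assume x: "r \<le> x" "x \<le> s"
  then have "(sharpness_weight has_real_derivative (4 / (1 - x)\<^sup>2 - 2 / (1 - x))) (at x)"
    unfolding sharpness_weight_def using assms
    by (auto intro!: derivative_eq_intros simp: field_simps power2_eq_square)
  moreover have "4 / (1 - x)\<^sup>2 - 2 / (1 - x) > 0"
  proof -
    have "2 / (1 - x) = 2 * (1 - x) / (1 - x)\<^sup>2"
      using x assms by (simp add: power2_eq_square del: right_diff_distrib_numeral)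
    moreover have "2 * (1 - x) / (1 - x)\<^sup>2 < 4 / (1 - x)\<^sup>2"
      using x assms by (intro divide_strict_right_mono) auto
    ultimately show ?thesis by simp
  qed
  ultimately show "\<exists>y. (sharpness_weight has_real_derivative y) (at x) \<and> 0 < y" by blast
qed

lemma sharpness_weight_values: "sharpness_weight 0.299823 < 1" "sharpness_weight 0.299827 > 1"
proof -
  \<comment> \<open>Four terms of the inverse hyperbolic tangent series determine both logarithms to about seven digits.\<close>
  have "ln (1000000/700177::real) \<in> {0.3564218..0.3564222}"
    using ln_approx_bounds[of "1000000/700177" 4] by (simp add: eval_nat_numeral)
  moreover have "ln (1 - 0.299823::real) = - ln (1000000/700177)"
    by (subst ln_inverse[symmetric]) auto
  ultimately show "sharpness_weight 0.299823 < 1" unfolding sharpness_weight_def by simp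
  have "ln (1000000/700173::real) \<in> {0.356427..0.356428}"
    using ln_approx_bounds[of "1000000/700173" 4] by (simp add: eval_nat_numeral)
  moreover have "ln (1 - 0.299827::real) = - ln (1000000/700173)"
    by (subst ln_inverse[symmetric]) auto
  ultimately show "sharpness_weight 0.299827 > 1" unfolding sharpness_weight_def by simp
qed

lemma sharpness_weight_continuous: "continuous_on {0<..<1} sharpness_weight"
  unfolding sharpness_weight_def by (intro continuous_intros) auto

lemma unique_root:
  fixes f :: "real \<Rightarrow> real"
  assumes mono: "\<And>r s. 0 < r \<Longrightarrow> r < s \<Longrightarrow> s < 1 \<Longrightarrow> f r < f s"
    and cont: "continuous_on {0<..<1} f"
    and lu: "0 < l" "l < u" "u < 1" and c: "f l < c" "c < f u"
  obtains x where "l < x" "x < u" "f x = c"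
    "\<And>r. (0 < r \<and> r < 1 \<and> f r = c) \<longleftrightarrow> r = x"
proof -
  obtain x where x: "l \<le> x" "x \<le> u" "f x = c"
    using IVT'[of f l c u] continuous_on_subset[OF cont, of "{l..u}"] lu c by force
  with c have x': "l < x" "x < u" by (auto simp: less_le)
  show ?thesis
  proof (rule that[OF x' x(3)])
    show "(0 < r \<and> r < 1 \<and> f r = c) \<longleftrightarrow> r = x" for r
      using mono[of r x] mono[of x r] x x' lu by (cases r x rule: linorder_cases) auto
  qed
qed

section \<open>The majorant estimate\<close>

lemma sums_square_times_power:
  fixes x :: real
  assumes "norm x < 1"
  shows "(\<lambda>n. (real n)\<^sup>2 * x ^ n) sums (x * (1 + x) / (1 - x) ^ 3)"
proof -
  have "(\<lambda>n. diffs real n * x ^ n) sums ((1 + x) / (1 - x) ^ 3)"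
  proof (rule termdiffs_sums_strong[OF _ _ assms])
    fix y :: real assume y: "norm y < 1"
    show "(\<lambda>n. real n * y ^ n) sums (y / (1 - y)\<^sup>2)"
      using sums_Suc[of "\<lambda>n. real n * y ^ n"] sums_mult[OF geometric_deriv_sums[OF y], of y]
      by (simp add: mult_ac)
  next
    show "((\<lambda>y. y / (1 - y)\<^sup>2) has_real_derivative (1 + x) / (1 - x) ^ 3) (at x)"
      using assms
      by (auto intro!: derivative_eq_intros simp: divide_simps) (simp add: power2_eq_square power3_eq_cube power4_eq_xxxx algebra_simps)
  qed
  then have "(\<lambda>n. x * (diffs real n * x ^ n)) sums (x * ((1 + x) / (1 - x) ^ 3))"
    by (rule sums_mult)
  then show ?thesis
    using sums_Suc[of "\<lambda>n. (real n)\<^sup>2 * x ^ n"] by (simp add: diffs_def power2_eq_square mult_ac)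
qed

text \<open>The operator \<open>z d/dz\<close> keeps the index of a coefficient and multiplies it by \<open>n\<close>; this is the form in which
  \<open>z h'\<close> enters the comparison with \<open>g'\<close>.\<close>

lemma sums_euler_derivative:
  fixes a :: "nat \<Rightarrow> complex"
  assumes a: "\<And>z. norm z < 1 \<Longrightarrow> (\<lambda>n. a n * z ^ n) sums h z"
    and h: "h holomorphic_on unit_disk" and z: "norm z < 1"
  shows "(\<lambda>n. diffs a n * z ^ n) sums deriv h z"
    and "(\<lambda>n. of_nat n * a n * z ^ n) sums (z * deriv h z)"
proof -
  show *: "(\<lambda>n. diffs a n * z ^ n) sums deriv h z"
    by (rule termdiffs_sums_strong[OF a _ z])
       (use z in \<open>auto intro: holomorphic_derivI[OF h]\<close>)
  show "(\<lambda>n. of_nat n * a n * z ^ n) sums (z * deriv h z)"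
    using sums_Suc[of "\<lambda>n. of_nat n * a n * z ^ n"] sums_mult[OF *, of z]
    by (simp add: diffs_def mult_ac)
qed

text \<open>The dilatation \<open>g'/h'\<close> is a holomorphic self-map of the disk that fixes \<open>0\<close>, so this is the
  Schwarz lemma.\<close>

lemma dilatation_bound:
  assumes h: "h holomorphic_on unit_disk" and g: "g holomorphic_on unit_disk"
    and jac: "\<And>z. norm z < 1 \<Longrightarrow> harmonic_jacobian h g z > 0"
    and g0: "deriv g 0 = 0" and z: "norm z < 1"
  shows "norm (deriv g z) \<le> norm (z * deriv h z)"
proof -
  have lt: "norm (deriv g w) < norm (deriv h w)" if "norm w < 1" for w
    using jac[OF that] by (auto simp: harmonic_jacobian_def intro: power2_less_imp_less)
  then have nz: "deriv h w \<noteq> 0" if "norm w < 1" for w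
    using that by fastforce
  define \<omega> where "\<omega> w = deriv g w / deriv h w" for w
  have "norm (\<omega> z) \<le> norm z"
  proof (rule Schwarz_Lemma(1)[OF _ _ _ z])
    show "\<omega> holomorphic_on unit_disk"
      unfolding \<omega>_def using nz by (intro holomorphic_intros h g) auto
    show "\<omega> 0 = 0" by (simp add: \<omega>_def g0)
    show "norm (\<omega> w) < 1" if "norm w < 1" for w
      using lt[OF that] nz[OF that] by (simp add: \<omega>_def norm_divide)
  qed
  then show ?thesis
    using nz[OF z] by (simp add: \<omega>_def norm_divide norm_mult pos_divide_le_eq)
qed

lemma sum_inverse_squares_le: "(\<Sum>n<N. (1 / real (n + 2))\<^sup>2) \<le> pi\<^sup>2 / 6 - 1"
proof -
  have "(\<lambda>n. 1 / (real (Suc n) + 1)\<^sup>2) sums (pi\<^sup>2 / 6 - 1)"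
    using sums_Suc_iff[of "\<lambda>n. 1 / (real n + 1)\<^sup>2"] inverse_squares_sums by (simp add: add.commute)
  then have "(\<lambda>n. (1 / real (n + 2))\<^sup>2) sums (pi\<^sup>2 / 6 - 1)"
    by (simp add: power_divide add_ac)
  from sum_le_suminf[OF sums_summable[OF this], of "{..<N}"] sums_unique[OF this] show ?thesis by simp
qed

text \<open>The analytic part is compared with a geometric series. The co-analytic part is written as
  \<open>r \<Sum> (1/n) (n \<bar>b\<^sub>n\<bar> r\<^bsup>n-1\<^esup>)\<close> over \<open>n \<ge> 2\<close> and estimated by the Cauchy-Schwarz inequality. The weight \<open>1/n\<close> makes
  the second factor the square mean of \<open>g'\<close>, which the dilatation controls.\<close>

lemma majorant_sum_le:
  assumes f: "sense_preserving_harmonic_mapping f h g" and ab: "has_coefficients h g a b"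
    and le: "\<And>z. norm z < 1 \<Longrightarrow> norm (h z) \<le> M"
    and M: "M > 0" and r: "0 \<le> r" "r < 1"
  shows "majorant_sum a b r \<le> norm (a 0) + (M - (norm (a 0))\<^sup>2 / M) * bohr_weight r"
proof -
  define K where "K = M - (norm (a 0))\<^sup>2 / M"
  have h: "h holomorphic_on unit_disk" and g: "g holomorphic_on unit_disk"
    and jac: "\<And>z. norm z < 1 \<Longrightarrow> harmonic_jacobian h g z > 0"
    using f by (auto simp: sense_preserving_harmonic_mapping_def)
  have a: "(\<lambda>n. a n * z ^ n) sums h z" if "norm z < 1" for z
    using ab that by (auto simp: has_coefficients_def)
  have aK: "norm (a (Suc n)) \<le> K" for n
    unfolding K_def by (rule bounded_power_series_coeff_le[OF a le M]) auto
  then have K: "K \<ge> 0" by (meson norm_ge_zero order_trans)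
  \<comment> \<open>The expansion of \<open>g\<close> starts at index \<open>2\<close>, so the lower coefficients are zero.\<close>
  define B where "B n = (if n < 2 then 0 else b n)" for n
  have B: "(\<lambda>n. B n * z ^ n) sums g z" if "norm z < 1" for z
  proof -
    have "(\<lambda>n. B (n + 2) * z ^ (n + 2)) sums g z"
      using ab that by (auto simp: has_coefficients_def B_def)
    then show ?thesis
      by (subst (asm) sums_iff_shift) (simp add: B_def)
  qed
  have "deriv g 0 = 0"
    using sums_euler_derivative(1)[OF B g, of 0] powser_sums_zero_iff[of "diffs B" "deriv g 0"]
    by (simp add: diffs_def B_def)
  note dil = dilatation_bound[OF h g jac this]
  note l2 = power_series_l2_mono[OF sums_euler_derivative(1)[OF B g] sums_euler_derivative(2)[OF a h] dil r]
  have analytic: "summable (\<lambda>n. norm (a n) * r ^ n)"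
    "(\<Sum>n. norm (a n) * r ^ n) \<le> norm (a 0) + K * (r / (1 - r))"
  proof -
    have geo: "(\<lambda>n. K * r * r ^ n) sums (K * r * (1 / (1 - r)))"
      by (intro sums_mult geometric_sums) (use r in auto)
    have cmp: "norm (a (Suc n)) * r ^ Suc n \<le> K * r * r ^ n" for n
      using mult_right_mono[OF aK[of n], of "r ^ Suc n"] r by (simp add: mult_ac)
    have s: "summable (\<lambda>n. norm (a (Suc n)) * r ^ Suc n)"
      by (rule summable_comparison_test'[OF sums_summable[OF geo], of 0]) (use cmp r in auto)
    then show s': "summable (\<lambda>n. norm (a n) * r ^ n)"
      by (subst (asm) summable_Suc_iff)
    have "(\<Sum>n. norm (a (Suc n)) * r ^ Suc n) \<le> K * r * (1 / (1 - r))"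
      using suminf_le[OF cmp s sums_summable[OF geo]] sums_unique[OF geo] by simp
    then show "(\<Sum>n. norm (a n) * r ^ n) \<le> norm (a 0) + K * (r / (1 - r))"
      using suminf_split_head[OF s'] by simp
  qed
  define Q where "Q = (1 + r\<^sup>2) / (1 - r\<^sup>2) ^ 3"
  have r2: "norm (r\<^sup>2) < 1" using r by (simp add: abs_square_less_1)
  have Q: "Q \<ge> 0" using r2 by (simp add: Q_def)
  have "(\<Sum>n. (norm (of_nat n * a n) * r ^ n)\<^sup>2) \<le> K\<^sup>2 * (r\<^sup>2 * Q)"
  proof -
    have s: "(\<lambda>n. K\<^sup>2 * ((real n)\<^sup>2 * (r\<^sup>2) ^ n)) sums (K\<^sup>2 * (r\<^sup>2 * Q))"
      unfolding Q_def using sums_mult[OF sums_square_times_power[OF r2], of "K\<^sup>2"] by simp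
    have "(norm (of_nat n * a n) * r ^ n)\<^sup>2 \<le> K\<^sup>2 * ((real n)\<^sup>2 * (r\<^sup>2) ^ n)" for n
    proof (cases n)
      case (Suc m)
      have "(norm (of_nat n * a n) * r ^ n)\<^sup>2 = (norm (a n))\<^sup>2 * ((real n)\<^sup>2 * (r\<^sup>2) ^ n)"
        by (simp add: norm_mult power_mult_distrib power_mult[symmetric] mult_ac)
      also have "\<dots> \<le> K\<^sup>2 * ((real n)\<^sup>2 * (r\<^sup>2) ^ n)"
        using aK[of m] Suc by (intro mult_right_mono power_mono) auto
      finally show ?thesis .
    qed simp
    from suminf_le[OF this l2(2) sums_summable[OF s]] show ?thesis
      by (simp add: sums_unique[OF s, symmetric])
  qed
  with l2(3) have T: "(\<Sum>n. (norm (diffs B n) * r ^ n)\<^sup>2) \<le> K\<^sup>2 * (r\<^sup>2 * Q)" by linarith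
  have partial: "(\<Sum>n<N. norm (b (n + 2)) * r ^ (n + 2)) \<le> K * (r\<^sup>2 * sqrt Q * sqrt (pi\<^sup>2 / 6 - 1))" for N
  proof -
    define u where "u n = 1 / real (n + 2)" for n
    define v where "v n = norm (diffs B (Suc n)) * r ^ Suc n" for n
    have "summable (\<lambda>n. (norm (diffs B (Suc n)) * r ^ Suc n)\<^sup>2)"
      using l2(1) by (subst summable_Suc_iff[where f = "\<lambda>n. (norm (diffs B n) * r ^ n)\<^sup>2"])
    then have "(\<Sum>n<N. (v n)\<^sup>2) \<le> (\<Sum>n. (norm (diffs B (Suc n)) * r ^ Suc n)\<^sup>2)"
      unfolding v_def by (rule sum_le_suminf) auto
    also have "\<dots> \<le> (\<Sum>n. (norm (diffs B n) * r ^ n)\<^sup>2)"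
      using suminf_split_head[OF l2(1)] by simp
    finally have v: "(\<Sum>n<N. (v n)\<^sup>2) \<le> K\<^sup>2 * (r\<^sup>2 * Q)" using T by linarith
    have "(\<Sum>n<N. u n * v n)\<^sup>2 \<le> (\<Sum>n<N. (u n)\<^sup>2) * (\<Sum>n<N. (v n)\<^sup>2)"
      by (rule Cauchy_Schwarz_ineq_sum)
    also have "\<dots> \<le> (pi\<^sup>2 / 6 - 1) * (K\<^sup>2 * (r\<^sup>2 * Q))"
      using sum_inverse_squares_le[of N] sum_inverse_squares_le[of 0] v unfolding u_def
      by (intro mult_mono) (auto intro: sum_nonneg)
    finally have "(\<Sum>n<N. u n * v n) \<le> sqrt ((pi\<^sup>2 / 6 - 1) * (K\<^sup>2 * (r\<^sup>2 * Q)))"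
      by (rule real_le_rsqrt)
    also have "\<dots> = sqrt (pi\<^sup>2 / 6 - 1) * (K * (r * sqrt Q))"
      using K r by (simp add: real_sqrt_mult)
    finally have "r * (\<Sum>n<N. u n * v n) \<le> r * (sqrt (pi\<^sup>2 / 6 - 1) * (K * (r * sqrt Q)))"
      using r by (intro mult_left_mono)
    moreover have eq: "norm (b (n + 2)) * r ^ (n + 2) = r * (u n * v n)" for n
    proof -
      have "norm (diffs B (Suc n)) = real (n + 2) * norm (b (n + 2))"
        by (simp add: diffs_def B_def norm_mult del: of_nat_Suc of_nat_add)
      then show ?thesis unfolding u_def v_def by (simp del: of_nat_add)
    qed
    ultimately show ?thesis
      unfolding eq sum_distrib_left[symmetric] by (simp add: power2_eq_square mult_ac)
  qed
  have nonneg: "0 \<le> norm (b (n + 2)) * r ^ (n + 2)" for n using r by simp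
  have "(\<Sum>n. norm (b (n + 2)) * r ^ (n + 2)) \<le> K * (r\<^sup>2 * sqrt Q * sqrt (pi\<^sup>2 / 6 - 1))"
    by (intro suminf_le_const summableI_nonneg_bounded[OF nonneg partial] partial)
  with analytic(2) show ?thesis
    unfolding majorant_sum_def bohr_weight_def Q_def[symmetric] K_def[symmetric] by (simp add: distrib_left)
qed

lemma disk_sup_norm_upper:
  assumes "bounded (h ` unit_disk)" "norm z < 1"
  shows "norm (h z) \<le> disk_sup_norm h"
  unfolding disk_sup_norm_def
proof (rule cSUP_upper)
  show "bdd_above ((\<lambda>z. norm (h z)) ` unit_disk)"
    using assms(1) by (auto simp: bounded_iff bdd_above_def)
qed (use assms in auto)

lemma majorant_sum_le_sup_norm:
  assumes f: "sense_preserving_harmonic_mapping f h g" and ab: "has_coefficients h g a b"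
    and bdd: "bounded (h ` unit_disk)" and r: "0 \<le> r" "r < 1" and F: "bohr_weight r \<le> 1 / 2"
  shows "majorant_sum a b r \<le> disk_sup_norm h"
proof -
  define M where "M = disk_sup_norm h"
  have le: "norm (h z) \<le> M" if "norm z < 1" for z
    unfolding M_def by (rule disk_sup_norm_upper[OF bdd that])
  have a: "(\<lambda>n. a n * z ^ n) sums h z" if "norm z < 1" for z
    using ab that by (auto simp: has_coefficients_def)
  \<comment> \<open>If \<open>h\<close> vanished identically, so would \<open>h'\<close>, and the Jacobian could not be positive.\<close>
  have M: "M > 0"
  proof (rule ccontr)
    assume "\<not> M > 0"
    then have "h z = 0" if "z \<in> unit_disk" for z
      using le[of z] that by (smt (verit) dist_0_norm mem_ball norm_le_zero_iff)
    then have "deriv h 0 = deriv (\<lambda>_. 0) 0"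
      by (intro deriv_cong_ev) (auto simp: eventually_nhds intro!: exI[of _ unit_disk])
    with f show False
      by (auto simp: sense_preserving_harmonic_mapping_def harmonic_jacobian_def dest!: bspec[of _ _ 0])
  qed
  \<comment> \<open>The factor is nonnegative because it bounds \<open>\<bar>a\<^sub>1\<bar>\<close>.\<close>
  have K: "0 \<le> M - (norm (a 0))\<^sup>2 / M"
    using bounded_power_series_coeff_le[OF a le M, of 1] by (smt (verit) norm_ge_zero zero_less_one)
  have "majorant_sum a b r \<le> norm (a 0) + (M - (norm (a 0))\<^sup>2 / M) * bohr_weight r"
    by (rule majorant_sum_le[OF f ab le M r])
  also have "\<dots> \<le> norm (a 0) + (M - (norm (a 0))\<^sup>2 / M) * (1 / 2)"
    using mult_left_mono[OF F K] by simp
  also have "\<dots> \<le> M"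
  proof -
    \<comment> \<open>The slack in the inequality is half of this square.\<close>
    have "0 \<le> (M - norm (a 0))\<^sup>2 / M" using M by simp
    also have "\<dots> = M - 2 * norm (a 0) + (norm (a 0))\<^sup>2 / M"
      using M by (simp add: power2_diff field_simps power2_eq_square)
    finally show ?thesis by (simp add: diff_divide_distrib)
  qed
  finally show ?thesis by (simp add: M_def)
qed

section \<open>Harmonicity of a holomorphic plus a conjugate holomorphic function\<close>

text \<open>Stated for any \<open>f\<close> that agrees with \<open>h + cnj g\<close> on the open set, so that it also applies to the partial derivatives
  of \<open>f\<close>, which have this form only on that set.\<close>

lemma real_derivative_harmonic:
  assumes S: "open S" "z \<in> S" and h: "h holomorphic_on S" and g: "g holomorphic_on S"
    and f: "\<And>w. w \<in> S \<Longrightarrow> f w = h w + cnj (g w)"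
  shows "(f has_derivative (\<lambda>v. deriv h z * v + cnj (deriv g z * v))) (at z)"
proof -
  have "(h has_derivative (\<lambda>v. deriv h z * v)) (at z)" "(g has_derivative (\<lambda>v. deriv g z * v)) (at z)"
    using holomorphic_derivI[OF h S] holomorphic_derivI[OF g S] by (auto simp: has_field_derivative_def)
  then have "((\<lambda>w. h w + cnj (g w)) has_derivative (\<lambda>v. deriv h z * v + cnj (deriv g z * v))) (at z)"
    by (intro has_derivative_add has_derivative_cnj)
  then show ?thesis
    by (rule has_derivative_transform_within_open[OF _ S]) (simp add: f)
qed

lemma directional_derivative_harmonic:
  assumes S: "open S" "z \<in> S" and h: "h holomorphic_on S" and g: "g holomorphic_on S"
    and f: "\<And>w. w \<in> S \<Longrightarrow> f w = h w + cnj (g w)"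
  shows "vector_derivative (\<lambda>t. f (z + v * of_real t)) (at 0) = v * deriv h z + cnj (v * deriv g z)"
proof (rule vector_derivative_at, unfold has_vector_derivative_def)
  have "((\<lambda>t. z + v * of_real t) has_derivative (\<lambda>t. v * of_real t)) (at 0)"
    by (auto intro!: derivative_eq_intros)
  moreover have "(f has_derivative (\<lambda>w. deriv h z * w + cnj (deriv g z * w))) (at (z + v * of_real 0))"
    using real_derivative_harmonic[OF S h g f] by simp
  ultimately have "((\<lambda>t. f (z + v * of_real t)) has_derivative
      (\<lambda>t. deriv h z * (v * of_real t) + cnj (deriv g z * (v * of_real t)))) (at 0)"
    by (rule has_derivative_compose)
  then show "((\<lambda>t. f (z + v * of_real t)) has_derivative
      (\<lambda>t. t *\<^sub>R (v * deriv h z + cnj (v * deriv g z)))) (at 0)"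
    by (simp add: scaleR_conv_of_real algebra_simps)
qed

lemma partials_harmonic:
  assumes S: "open S" and h: "h holomorphic_on S" and g: "g holomorphic_on S"
    and f: "\<And>w. w \<in> S \<Longrightarrow> f w = h w + cnj (g w)"
  shows "z \<in> S \<Longrightarrow> partial_x f z = deriv h z + cnj (deriv g z)"
    and "z \<in> S \<Longrightarrow> partial_y f z = \<i> * deriv h z + cnj (\<i> * deriv g z)"
    and "C1_on f S"
proof -
  show px: "partial_x f z = deriv h z + cnj (deriv g z)" if "z \<in> S" for z
    using directional_derivative_harmonic[OF S that h g f, of 1] by (simp add: partial_x_def)
  show py: "partial_y f z = \<i> * deriv h z + cnj (\<i> * deriv g z)" if "z \<in> S" for z
    using directional_derivative_harmonic[OF S that h g f, of \<i>] by (simp add: partial_y_def)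
  have "continuous_on S (deriv h)" "continuous_on S (deriv g)"
    using holomorphic_deriv[OF h S] holomorphic_deriv[OF g S] by (auto intro: holomorphic_on_imp_continuous_on)
  then have "continuous_on S (\<lambda>z. deriv h z + cnj (deriv g z))"
    "continuous_on S (\<lambda>z. \<i> * deriv h z + cnj (\<i> * deriv g z))"
    by (auto intro!: continuous_intros)
  then show "C1_on f S"
    unfolding C1_on_def
    using real_derivative_harmonic[OF S _ h g f] by (auto simp: px py differentiable_def cong: continuous_on_cong)
qed

text \<open>Both partial derivatives are again of the form holomorphic plus conjugate holomorphic: \<open>\<partial>/\<partial>x\<close> replaces
  \<open>(h, g)\<close> by \<open>(h', g')\<close>, and \<open>\<partial>/\<partial>y\<close> by \<open>(\<i> h', \<i> g')\<close>. Two steps give second derivatives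
  that differ by the factor \<open>\<i>\<^sup>2 = -1\<close>.\<close>

lemma harmonic_on_holomorphic_add_cnj:
  assumes S: "open S" and h: "h holomorphic_on S" and g: "g holomorphic_on S"
  shows "harmonic_on (\<lambda>z. h z + cnj (g z)) S"
proof -
  let ?f = "\<lambda>z. h z + cnj (g z)"
  have h': "deriv h holomorphic_on S" and g': "deriv g holomorphic_on S"
    by (rule holomorphic_deriv[OF h S] holomorphic_deriv[OF g S])+
  have ih: "(\<lambda>z. \<i> * deriv h z) holomorphic_on S" and ig: "(\<lambda>z. \<i> * deriv g z) holomorphic_on S"
    by (intro holomorphic_intros h' g')+
  note f = partials_harmonic[OF S h g refl]
  note fx = partials_harmonic[OF S h' g', of "partial_x ?f", OF f(1)]
  note fy = partials_harmonic[OF S ih ig, of "partial_y ?f", OF f(2)]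
  have "laplacian ?f z = 0" if z: "z \<in> S" for z
  proof -
    have "deriv h field_differentiable at z" "deriv g field_differentiable at z"
      using h' g' S z holomorphic_on_imp_differentiable_at by blast+
    then show ?thesis
      using fx(1)[OF _ z] fy(2)[OF _ z] by (simp add: laplacian_def)
  qed
  then show ?thesis
    unfolding harmonic_on_def C2_on_def using f(3) fx(3) fy(3) by blast
qed

section \<open>The extremal family\<close>

text \<open>The family \<open>h(z) = (z - t)/(1 - t z)\<close>, \<open>g' = z h'\<close>. The dilatation is \<open>z\<close>, so the mapping is sense-preserving
  because \<open>h'\<close> has no zero. Integration of \<open>z h' = \<Sum> n a\<^sub>n z\<^sup>n\<close> gives
  \<open>b\<^sub>n\<^sub>+\<^sub>1 = n a\<^sub>n/(n + 1)\<close>; defining \<open>g\<close> by this series avoids the logarithm of its closed form.\<close>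

lemma Moebius_example:
  fixes t :: real
  assumes t: "0 < t" "t < 1"
  shows "\<exists>f h g a b. sense_preserving_harmonic_mapping f h g \<and> has_coefficients h g a b \<and>
    bounded (h ` unit_disk) \<and> disk_sup_norm h \<le> 1 \<and>
    norm (a 0) = t \<and> (\<forall>n. norm (a (Suc n)) = (1 - t\<^sup>2) * t ^ n) \<and>
    (\<forall>n. norm (b (n + 2)) = real (n + 1) / real (n + 2) * ((1 - t\<^sup>2) * t ^ n))"
proof -
  define h where "h = Moebius_function 0 (of_real t)"
  define a :: "nat \<Rightarrow> complex" where
    "a n = (case n of 0 \<Rightarrow> - of_real t | Suc m \<Rightarrow> of_real ((1 - t\<^sup>2) * t ^ m))" for n
  define b :: "nat \<Rightarrow> complex" where "b n = (case n of 0 \<Rightarrow> 0 | Suc m \<Rightarrow> of_nat m / of_nat (Suc m) * a m)" for n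
  define g where "g z = (\<Sum>n. b n * z ^ n)" for z
  have t2: "0 < 1 - t\<^sup>2" "1 - t\<^sup>2 < 1" using t by (auto simp: abs_square_less_1)
  have h_eq: "h z = (z - of_real t) / (1 - of_real t * z)" for z
    by (simp add: h_def Moebius_function_simple)
  have tz: "norm (of_real t * z) < 1" if "norm z < 1" for z :: complex
    using mult_strict_mono[of t 1 "norm z" 1] t that by (simp add: norm_mult)
  then have nz: "1 - of_real t * z \<noteq> 0" if "norm z < 1" for z :: complex
    using tz[OF that] by auto
  have h_lt: "norm (h z) < 1" if "norm z < 1" for z
    unfolding h_def using t that by (intro Moebius_function_norm_lt_1) auto
  have h_hol: "h holomorphic_on unit_disk"
    unfolding h_def using t by (intro Moebius_function_holomorphic) auto
  have a_sums: "(\<lambda>n. a n * z ^ n) sums h z" if z: "norm z < 1" for z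
  proof -
    have "(\<lambda>n. a (Suc n) * z ^ Suc n) sums (of_real (1 - t\<^sup>2) * z * (1 / (1 - of_real t * z)))"
      using sums_mult[OF geometric_sums[OF tz[OF z]], of "of_real (1 - t\<^sup>2) * z"]
      by (simp add: a_def power_mult_distrib mult_ac)
    from sums_Suc[OF this] show ?thesis
      using nz[OF z] by (simp add: h_eq a_def field_simps power2_eq_square)
  qed
  have norm_a: "norm (a n) \<le> 1" for n
    using t t2 mult_mono[of "1 - t\<^sup>2" 1 "t ^ (n - 1)" 1]
    by (auto simp: a_def norm_mult norm_power power_le_one split: nat.split simp del: of_real_diff of_real_power)
  have norm_b: "norm (b n) \<le> 1" for n
  proof (cases n)
    case (Suc m)
    have "norm (b n) = real m / real (Suc m) * norm (a m)"
      using Suc by (simp add: b_def norm_mult norm_divide del: of_nat_Suc)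
    also have "\<dots> \<le> 1 * 1" by (intro mult_mono norm_a) auto
    finally show ?thesis by simp
  qed (simp add: b_def)
  have b_summable: "summable (\<lambda>n. b n * z ^ n)" if "norm z < 1" for z
  proof (rule summable_comparison_test'[of "\<lambda>n. norm z ^ n" 0])
    show "summable (\<lambda>n. norm z ^ n)" using that by (simp add: summable_geometric)
    show "norm (b n * z ^ n) \<le> norm z ^ n" for n
      using norm_b[of n] by (simp add: norm_mult norm_power mult_left_le_one_le)
  qed
  have g_sums: "(\<lambda>n. b n * z ^ n) sums g z" if "norm z < 1" for z
    unfolding g_def using b_summable[OF that] by (rule summable_sums)
  have g_deriv: "(g has_field_derivative (z * deriv h z)) (at z)" if z: "norm z < 1" for z
  proof -
    have "(g has_field_derivative (\<Sum>n. diffs b n * z ^ n)) (at z)"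
      unfolding g_def by (rule termdiffs_strong'[OF b_summable z])
    moreover have "(\<lambda>n. diffs b n * z ^ n) sums (z * deriv h z)"
      using sums_euler_derivative(2)[OF a_sums h_hol z] by (simp add: diffs_def b_def del: of_nat_Suc)
    ultimately show ?thesis by (simp add: sums_iff)
  qed
  then have g_hol: "g holomorphic_on unit_disk"
    by (simp add: holomorphic_on_open Ball_def) blast
  have g_d: "deriv g z = z * deriv h z" if "norm z < 1" for z
    using g_deriv[OF that] by (rule DERIV_imp_deriv)
  have h_d: "deriv h z \<noteq> 0" if z: "norm z < 1" for z
  proof -
    have "(h has_field_derivative of_real (1 - t\<^sup>2) / (1 - of_real t * z)\<^sup>2) (at z)"
      unfolding h_eq[abs_def] using nz[OF z]
      by (auto intro!: derivative_eq_intros simp: field_simps power2_eq_square)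
    then have "deriv h z = of_real (1 - t\<^sup>2) / (1 - of_real t * z)\<^sup>2" by (rule DERIV_imp_deriv)
    then show ?thesis using t2 nz[OF z] by (simp del: of_real_diff)
  qed
  have jac: "harmonic_jacobian h g z > 0" if z: "norm z < 1" for z
  proof -
    have "harmonic_jacobian h g z = (1 - (norm z)\<^sup>2) * (norm (deriv h z))\<^sup>2"
      by (simp add: harmonic_jacobian_def g_d[OF z] norm_mult algebra_simps)
    then show ?thesis using h_d[OF z] z by (simp add: abs_square_less_1)
  qed
  have "sense_preserving_harmonic_mapping (\<lambda>z. h z + cnj (g z)) h g"
    unfolding sense_preserving_harmonic_mapping_def
    using harmonic_on_holomorphic_add_cnj[OF open_ball h_hol g_hol] h_hol g_hol jac
    by (auto simp: g_def b_def)
  moreover have "has_coefficients h g a b"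
    unfolding has_coefficients_def
  proof (intro conjI ballI)
    fix z assume "z \<in> unit_disk"
    then have z: "norm z < 1" by simp
    show "(\<lambda>n. a n * z ^ n) sums h z" by (rule a_sums[OF z])
    show "(\<lambda>n. b (n + 2) * z ^ (n + 2)) sums g z"
    proof -
      have "(\<Sum>i<2. b i * z ^ i) = 0" by (simp add: b_def numeral_2_eq_2)
      then show ?thesis
        by (subst sums_iff_shift[where f = "\<lambda>n. b n * z ^ n"]) (simp only: add_0_right g_sums[OF z])
    qed
  qed
  moreover have "bounded (h ` unit_disk)"
    using h_lt by (auto simp: bounded_iff intro!: exI[of _ 1] less_imp_le)
  moreover have "disk_sup_norm h \<le> 1"
    unfolding disk_sup_norm_def by (rule cSUP_least) (use h_lt in \<open>auto intro: less_imp_le\<close>)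
  moreover have "norm (a 0) = t" using t by (simp add: a_def)
  moreover have na: "norm (a (Suc n)) = (1 - t\<^sup>2) * t ^ n" for n
    using t t2 by (simp add: a_def norm_mult norm_power del: of_real_diff of_real_power)
  moreover have "norm (b (n + 2)) = real (n + 1) / real (n + 2) * ((1 - t\<^sup>2) * t ^ n)" for n
  proof -
    have eq: "b (n + 2) = of_nat (n + 1) / of_nat (n + 2) * a (Suc n)" by (simp add: b_def)
    show ?thesis unfolding eq norm_mult norm_divide norm_of_nat na ..
  qed
  ultimately show ?thesis by blast
qed

text \<open>The factor of \<open>(1 - t\<^sup>2) t\<^sup>n\<close> in \<open>\<bar>a\<^sub>n\<^sub>+\<^sub>1\<bar> r\<^bsup>n+1\<^esup> + \<bar>b\<^sub>n\<^sub>+\<^sub>2\<bar> r\<^bsup>n+2\<^esup>\<close> for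
  the Moebius family.\<close>

definition Moebius_weight :: "real \<Rightarrow> nat \<Rightarrow> real" where
  "Moebius_weight r n = r ^ (n + 1) + real (n + 1) / real (n + 2) * r ^ (n + 2)"

text \<open>Writing \<open>(n + 1)/(n + 2) = 1 - 1/(n + 2)\<close> splits the sum into two geometric series and the
  logarithmic series without its first term.\<close>

lemma Moebius_weight_sums:
  assumes r: "0 < r" "r < 1"
  shows "Moebius_weight r sums (sharpness_weight r / 2)"
proof -
  have geo: "(\<lambda>n. r ^ n) sums (1 / (1 - r))" using r by (intro geometric_sums) auto
  have "(\<lambda>n. - (r ^ n) / real n) sums ln (1 - r)"
    using ln_series'[of "- r"] r by simp
  then have "(\<lambda>n. - (r ^ (n + 2)) / real (n + 2)) sums (ln (1 - r) + r)"
    by (subst sums_iff_shift) (simp add: numeral_2_eq_2)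
  from sums_add[OF sums_add[OF sums_mult[OF geo, of r] sums_mult[OF geo, of "r\<^sup>2"]] this]
  have "(\<lambda>n. r * r ^ n + r\<^sup>2 * r ^ n + - (r ^ (n + 2)) / real (n + 2)) sums
      (r * (1 / (1 - r)) + r\<^sup>2 * (1 / (1 - r)) + (ln (1 - r) + r))" .
  moreover have "r * (1 / (1 - r)) + r\<^sup>2 * (1 / (1 - r)) + (ln (1 - r) + r) = sharpness_weight r / 2"
  proof -
    have "r\<^sup>2 * (1 / (1 - r)) = r / (1 - r) - r"
      using r by (simp add: field_simps power2_eq_square)
    then show ?thesis by (simp add: sharpness_weight_def)
  qed
  moreover have "r * r ^ n + r\<^sup>2 * r ^ n + - (r ^ (n + 2)) / real (n + 2) = Moebius_weight r n" for n
    by (simp add: Moebius_weight_def field_simps power2_eq_square)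
  ultimately show ?thesis by (simp only:)
qed

text \<open>The limit \<open>t \<rightarrow> 1\<close> is taken in a partial sum, a polynomial in \<open>t\<close>, which already exceeds the
  threshold; the remaining terms of the majorant sum are nonnegative.\<close>

lemma majorant_sum_exceeds_sup_norm:
  assumes r: "0 < r" "r < 1" and G: "sharpness_weight r > 1"
  shows "\<exists>f h g a b. sense_preserving_harmonic_mapping f h g \<and> has_coefficients h g a b \<and>
    bounded (h ` unit_disk) \<and> \<not> majorant_sum a b r \<le> disk_sup_norm h"
proof -
  have "eventually (\<lambda>N. (\<Sum>n<N. Moebius_weight r n) > 1 / 2) sequentially"
    using Moebius_weight_sums[OF r] G unfolding sums_def by (intro order_tendstoD) auto
  then obtain N where N: "(\<Sum>n<N. Moebius_weight r n) > 1 / 2"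
    by (auto simp: eventually_sequentially)
  define P where "P t = (1 + t) * (\<Sum>n<N. t ^ n * Moebius_weight r n)" for t
  have "(P \<longlongrightarrow> (1 + 1) * (\<Sum>n<N. 1 ^ n * Moebius_weight r n)) (at_left 1)"
    unfolding P_def by (intro tendsto_intros)
  then have "eventually (\<lambda>t. P t > 1) (at_left 1)"
    by (rule order_tendstoD) (use N in simp)
  moreover have "eventually (\<lambda>t. t \<in> {0<..<1}) (at_left (1::real))"
    by (rule eventually_at_left_real) simp
  ultimately have "eventually (\<lambda>t. P t > 1 \<and> t \<in> {0<..<1}) (at_left 1)"
    by (rule eventually_conj)
  then obtain t where t: "P t > 1" "0 < t" "t < 1"
    by (auto dest!: eventually_happens)
  obtain f h g a b where ex: "sense_preserving_harmonic_mapping f h g" "has_coefficients h g a b"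
      "bounded (h ` unit_disk)" "disk_sup_norm h \<le> 1" "norm (a 0) = t"
    and a: "\<And>n. norm (a (Suc n)) = (1 - t\<^sup>2) * t ^ n"
    and b: "\<And>n. norm (b (n + 2)) = real (n + 1) / real (n + 2) * ((1 - t\<^sup>2) * t ^ n)"
    using Moebius_example[OF t(2,3)] by blast
  have t2: "1 - t\<^sup>2 > 0" using t by (simp add: abs_square_less_1)
  have tn: "t ^ n \<le> 1" for n using t by (simp add: power_le_one)
  have sg: "summable (\<lambda>n. r ^ n)" using r by simp
  have sa: "summable (\<lambda>n. norm (a n) * r ^ n)"
  proof -
    have "summable (\<lambda>n. norm (a (Suc n)) * r ^ Suc n)"
    proof (rule summable_comparison_test'[OF sg, of 0])
      show "norm (norm (a (Suc n)) * r ^ Suc n) \<le> r ^ n" for n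
      proof -
        have "norm (a (Suc n)) * r \<le> 1"
          unfolding a using mult_mono[OF mult_mono[of "1 - t\<^sup>2" 1 "t ^ n" 1], of r 1] t2 tn[of n] t r by simp
        from mult_right_mono[OF this, of "r ^ n"] show ?thesis using r by (simp add: mult_ac)
      qed
    qed
    then show ?thesis by (subst (asm) summable_Suc_iff)
  qed
  have sb: "summable (\<lambda>n. norm (b (n + 2)) * r ^ (n + 2))"
  proof (rule summable_comparison_test'[OF sg, of 0])
    show "norm (norm (b (n + 2)) * r ^ (n + 2)) \<le> r ^ n" for n
    proof -
      have "norm (b (n + 2)) \<le> 1 * (1 * 1)"
        unfolding b using t2 tn[of n] t by (intro mult_mono) auto
      then have "norm (b (n + 2)) * r ^ (n + 2) \<le> 1 * r ^ n"
        using r by (intro mult_mono power_decreasing) auto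
      then show ?thesis using r by simp
    qed
  qed
  \<comment> \<open>Since \<open>(1 - t\<^sup>2) = (1 - t) (1 + t)\<close>, the right-hand side is the truncated majorant sum.\<close>
  have "1 < t + (1 - t) * P t"
  proof -
    have "(1 - t) * 1 < (1 - t) * P t" using t by (intro mult_strict_left_mono) auto
    then show ?thesis by simp
  qed
  also have "\<dots> = norm (a 0) + (\<Sum>n<N. norm (a (Suc n)) * r ^ Suc n) + (\<Sum>n<N. norm (b (n + 2)) * r ^ (n + 2))"
    unfolding P_def Moebius_weight_def a b ex(5)
    by (simp add: sum_distrib_left sum.distrib[symmetric] add.assoc)
       (auto intro!: sum.cong simp: algebra_simps power2_eq_square)
  also have "\<dots> \<le> majorant_sum a b r"
  proof -
    have "norm (a 0) + (\<Sum>n<N. norm (a (Suc n)) * r ^ Suc n) = (\<Sum>n<Suc N. norm (a n) * r ^ n)"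
      by (simp only: sum.lessThan_Suc_shift power_0 mult_1_right)
    also have "\<dots> \<le> (\<Sum>n. norm (a n) * r ^ n)"
      by (rule sum_le_suminf[OF sa]) (use r in auto)
    finally show ?thesis
      using sum_le_suminf[OF sb, of "{..<N}"] r unfolding majorant_sum_def by (simp add: add_mono)
  qed
  finally show ?thesis using ex by fastforce
qed

section \<open>The theorem on the radii\<close>

theorem corollary3:
  shows "\<exists>r_inf R :: real.
    (\<forall>r::real. (0 < r \<and> r < 1 \<and>
        r / (1 - r) + r\<^sup>2 * sqrt ((1 + r\<^sup>2) / (1 - r\<^sup>2) ^ 3) * sqrt (pi\<^sup>2 / 6 - 1) = 1 / 2)
      \<longleftrightarrow> r = r_inf) \<and>
    0.2942 \<le> r_inf \<and> r_inf < 0.2943 \<and>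
    (\<forall>f h g a b.
        sense_preserving_harmonic_mapping f h g \<and> has_coefficients h g a b \<and>
        bounded (h ` unit_disk) \<longrightarrow>
        (\<forall>r. 0 \<le> r \<and> r \<le> r_inf \<longrightarrow> majorant_sum a b r \<le> disk_sup_norm h)) \<and>
    (\<forall>r::real. (0 < r \<and> r < 1 \<and> 4 * r / (1 - r) + 2 * ln (1 - r) = 1) \<longleftrightarrow> r = R) \<and>
    \<bar>R - 0.299825\<bar> < 0.000002 \<and>
    (\<forall>r. R < r \<and> r < 1 \<longrightarrow>
      (\<exists>f h g a b.
        sense_preserving_harmonic_mapping f h g \<and> has_coefficients h g a b \<and>
        bounded (h ` unit_disk) \<and>
        \<not> majorant_sum a b r \<le> disk_sup_norm h))"
proof -
  obtain r_inf where r_inf: "0.2942 < r_inf" "r_inf < 0.2943" "bohr_weight r_inf = 1 / 2"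
    "\<And>r. (0 < r \<and> r < 1 \<and> bohr_weight r = 1 / 2) \<longleftrightarrow> r = r_inf"
    by (rule unique_root[OF bohr_weight_strict_mono bohr_weight_continuous _ _ _ bohr_weight_values]) auto
  obtain R where R: "0.299823 < R" "R < 0.299827" "sharpness_weight R = 1"
    "\<And>r. (0 < r \<and> r < 1 \<and> sharpness_weight r = 1) \<longleftrightarrow> r = R"
    by (rule unique_root[OF sharpness_weight_strict_mono sharpness_weight_continuous _ _ _ sharpness_weight_values]) auto
  have F: "bohr_weight r \<le> 1 / 2" if "0 \<le> r" "r \<le> r_inf" for r
  proof -
    consider "r = 0" | "r = r_inf" | "0 < r" "r < r_inf" using \<open>0 \<le> r\<close> \<open>r \<le> r_inf\<close> by linarith
    then show ?thesis
      using bohr_weight_strict_mono[of r r_inf] r_inf(2,3) by cases (auto simp: bohr_weight_def[of 0])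
  qed
  show ?thesis
  proof (rule exI[of _ r_inf], rule exI[of _ R], intro conjI allI impI)
    show "(0 < r \<and> r < 1 \<and> r / (1 - r) + r\<^sup>2 * sqrt ((1 + r\<^sup>2) / (1 - r\<^sup>2) ^ 3) * sqrt (pi\<^sup>2 / 6 - 1) = 1 / 2)
      \<longleftrightarrow> r = r_inf" for r
      using r_inf(4)[of r] by (simp only: bohr_weight_def)
    show "(0 < r \<and> r < 1 \<and> 4 * r / (1 - r) + 2 * ln (1 - r) = 1) \<longleftrightarrow> r = R" for r
      using R(4)[of r] by (simp only: sharpness_weight_def)
    show "\<bar>R - 0.299825\<bar> < 0.000002" using R by (simp add: abs_if)
    show "majorant_sum a b r \<le> disk_sup_norm h"
      if "sense_preserving_harmonic_mapping f h g \<and> has_coefficients h g a b \<and> bounded (h ` unit_disk)"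
        and r: "0 \<le> r \<and> r \<le> r_inf" for f h g a b r
      using that r_inf(2) F[of r] by (intro majorant_sum_le_sup_norm[of f h g]) auto
    show "\<exists>f h g a b. sense_preserving_harmonic_mapping f h g \<and> has_coefficients h g a b \<and>
        bounded (h ` unit_disk) \<and> \<not> majorant_sum a b r \<le> disk_sup_norm h"
      if "R < r \<and> r < 1" for r
      using that R sharpness_weight_strict_mono[of R r] by (intro majorant_sum_exceeds_sup_norm) auto
  qed (use r_inf in auto)
qed

end
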